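(* Let $n\ge1$, let $m=(m_0,\dots,m_n)$ be a sequence of non-negative integers, and assign weights to the edges of $\mathcal{G}^s_n$ as follows: the vertical edges, from left to right, have weights $a_0,a_1,\dots,a_n$; the top horizontal edges, from left to right, have weights $b_1,\dots,b_n$; the bottom horizontal edges, from left to right, have weights $c_1,\dots,c_n$. Define \[ X := U_{m_0}(a_0)\prod_{k=1}^n T_{m_{k-1},m_k}(b_kc_k)\,U_{m_k}(a_k), \] the product taken in left-to-right order of increasing $k$. Then for all $1\le i\le m_0+1$, $1\le j\le m_n+1$, the entry $X_{ij}$ equals $\sum_{\omega}\mathrm{wt}(\omega)$, summed over all $\omega\in\Omega^{ij}_{\mathbf{n}_m}(\mathcal{G}^s_n)$, where $\mathrm{wt}(\omega)$ is the product over all edges $e$ of (weight of $e$)$^{\omega(e)}$.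
   Context: Mixed dimer covers: for a finite graph $\mathcal{G}=(V,E)$ and $\mathbf{n}\colon V\to\mathbb{N}$, an $\mathbf{n}$-dimer cover is a function $\omega\colon E\to\mathbb{N}$ such that $\sum_{e\ni v}\omega(e)=\mathbf{n}(v)$ for every vertex $v$; the set of these is $\Omega_{\mathbf{n}}(\mathcal{G})$. $\mathcal{G}^s_n$ is the $2\times(n+1)$ grid graph with bottom vertices $v_{1,0},\dots,v_{1,n}$, top vertices $v_{2,0},\dots,v_{2,n}$, vertical edges $v_{1,k}v_{2,k}$ and horizontal edges $v_{r,k-1}v_{r,k}$. For $x=(x_0,\dots,x_n)$, $\mathbf{n}_x(v_{1,k})=\mathbf{n}_x(v_{2,k})=x_k$. $\Omega^{ij}_{\mathbf{n}_m}(\mathcal{G}^s_n):=\Omega_{\mathbf{n}_{m'}}(\mathcal{G}^s_n)$ with $m'=(m_0+1-i,m_1,\dots,m_{n-1},m_n+1-j)$. For a parameter $t$ and integer $N\ge0$, $U_N(t)$ is the $(N+1)\times(N+1)$ matrix whose $(i,j)$-entry is $t^{N+2-i-j}$ if $i+j\le N+2$ and $0$ otherwise. For integers $a,b\ge0$, $T_{a,b}(t)$ is the $(a+1)\times(b+1)$ matrix whose $(i,i)$-entry is $t^{i-1}$ (for $1\le i\le \min(a,b)+1$) and whose other entries are $0$. *)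

theory Defs
  imports "HOL-Library.FuncSet" "Jordan_Normal_Form.Matrix"
begin

text \<open>A finite simple graph is given by its vertex set \<open>V\<close> and its set \<open>E\<close> of edges, each edge being
  the set of its two endpoints. Covers are extensional functions on \<open>E\<close>, so that each function
  from \<open>E\<close> to the naturals is counted exactly once.\<close>

definition dimer_covers :: "'v set \<Rightarrow> 'v set set \<Rightarrow> ('v \<Rightarrow> nat) \<Rightarrow> ('v set \<Rightarrow> nat) set" where
  "dimer_covers V E d =
     {\<omega> \<in> E \<rightarrow>\<^sub>E (UNIV :: nat set). \<forall>v\<in>V. (\<Sum>e | e \<in> E \<and> v \<in> e. \<omega> e) = d v}"

text \<open>Sums over \<open>dimer_covers V E d\<close> are meaningful because this set is finite.\<close>

lemma finite_dimer_covers: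
  assumes "finite V" "finite E" "\<And>e. e \<in> E \<Longrightarrow> e \<inter> V \<noteq> {}"
  shows "finite (dimer_covers V E d)"
proof (rule finite_subset)
  show "dimer_covers V E d \<subseteq> E \<rightarrow>\<^sub>E {..sum d V}"
  proof
    fix \<omega> assume w: "\<omega> \<in> dimer_covers V E d"
    have "\<omega> e \<le> sum d V" if e: "e \<in> E" for e
    proof -
      from assms(3)[OF e] obtain v where v: "v \<in> e" "v \<in> V" by blast
      have "\<omega> e \<le> (\<Sum>e | e \<in> E \<and> v \<in> e. \<omega> e)"
        using e v assms(2) by (intro member_le_sum) auto
      also have "\<dots> = d v" using w v by (simp add: dimer_covers_def)
      also have "\<dots> \<le> sum d V" using v assms(1) by (intro member_le_sum) auto
      finally show ?thesis .
    qed
    thus "\<omega> \<in> E \<rightarrow>\<^sub>E {..sum d V}"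
      using w by (auto simp: dimer_covers_def PiE_iff)
  qed
  show "finite (E \<rightarrow>\<^sub>E {..sum d V})" using assms(2) by (intro finite_PiE) auto
qed

definition dimer_weight :: "'v set set \<Rightarrow> ('v set \<Rightarrow> 'a::comm_semiring_1) \<Rightarrow> ('v set \<Rightarrow> nat) \<Rightarrow> 'a" where
  "dimer_weight E w \<omega> = (\<Prod>e\<in>E. w e ^ \<omega> e)"

text \<open>The vertex in row \<open>r\<close> (1 is the bottom row, 2 the top row) and column \<open>k\<close> is \<open>(r, k)\<close>.\<close>

definition grid_verts :: "nat \<Rightarrow> (nat \<times> nat) set" where
  "grid_verts n = {1, 2} \<times> {0..n}"

definition vert_edge :: "nat \<Rightarrow> (nat \<times> nat) set" where
  "vert_edge k = {(1, k), (2, k)}"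

definition horiz_edge :: "nat \<Rightarrow> nat \<Rightarrow> (nat \<times> nat) set" where
  "horiz_edge r k = {(r, k - 1), (r, k)}"

definition grid_edges :: "nat \<Rightarrow> (nat \<times> nat) set set" where
  "grid_edges n = {vert_edge k | k. k \<le> n} \<union> {horiz_edge r k | r k. r \<in> {1, 2} \<and> k \<in> {1..n}}"

definition column_mult :: "(nat \<Rightarrow> nat) \<Rightarrow> nat \<times> nat \<Rightarrow> nat" where
  "column_mult x = (\<lambda>(r, k). x k)"

text \<open>For \<open>n \<ge> 1\<close>, the two updates concern different positions.\<close>

definition grid_dimer_covers ::
    "nat \<Rightarrow> (nat \<Rightarrow> nat) \<Rightarrow> nat \<Rightarrow> nat \<Rightarrow> ((nat \<times> nat) set \<Rightarrow> nat) set" where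
  "grid_dimer_covers n m i j =
     dimer_covers (grid_verts n) (grid_edges n)
       (column_mult (m(0 := m 0 + 1 - i, n := m n + 1 - j)))"

text \<open>Rows and columns of the type \<open>mat\<close> are numbered from 0: position \<open>(i, j)\<close> below is the
  \<open>(i + 1, j + 1)\<close>-entry in the usual numbering, where the condition reads \<open>i + j \<le> N + 2\<close> and the
  exponents are \<open>N + 2 - i - j\<close> and \<open>i - 1\<close>.\<close>

definition U_mat :: "nat \<Rightarrow> 'a::comm_semiring_1 \<Rightarrow> 'a mat" where
  "U_mat N t = mat (N + 1) (N + 1) (\<lambda>(i, j). if i + j \<le> N then t ^ (N - i - j) else 0)"

definition T_mat :: "nat \<Rightarrow> nat \<Rightarrow> 'a::comm_semiring_1 \<Rightarrow> 'a mat" where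
  "T_mat p q t = mat (p + 1) (q + 1) (\<lambda>(i, j). if i = j then t ^ i else 0)"

fun X_mat :: "(nat \<Rightarrow> nat) \<Rightarrow> (nat \<Rightarrow> 'a::comm_semiring_1) \<Rightarrow> (nat \<Rightarrow> 'a) \<Rightarrow> (nat \<Rightarrow> 'a) \<Rightarrow> nat \<Rightarrow> 'a mat" where
  "X_mat m a b c 0 = U_mat (m 0) (a 0)"
| "X_mat m a b c (Suc k) =
     X_mat m a b c k * T_mat (m k) (m (Suc k)) (b (Suc k) * c (Suc k)) * U_mat (m (Suc k)) (a (Suc k))"

end

theory Submission
  imports Defs
begin

text \<open>In the last column, the degree conditions of the two vertices force the top and bottom
  horizontal edges to have the same multiplicity \<open>K\<close>, and then determine the vertical edge. Removing the
  last column leaves a cover of the shorter grid whose last column has its multiplicity lowered by \<open>K\<close>.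
  This is the recursion that right multiplication by \<open>T\<close> and \<open>U\<close> expresses, since \<open>T\<close> is
  diagonal.\<close>

lemma grid_edges_0: "grid_edges 0 = {vert_edge 0}"
  by (auto simp: grid_edges_def)

lemma grid_edges_Suc:
  "grid_edges (Suc n) =
     insert (vert_edge (Suc n)) (insert (horiz_edge 1 (Suc n)) (insert (horiz_edge 2 (Suc n)) (grid_edges n)))"
  by (auto simp: grid_edges_def le_Suc_eq)

lemma finite_grid_edges: "finite (grid_edges n)"
  by (induction n) (auto simp: grid_edges_0 grid_edges_Suc)

lemma grid_edges_subset_verts: "e \<in> grid_edges n \<Longrightarrow> e \<subseteq> grid_verts n"
  by (auto simp: grid_edges_def grid_verts_def vert_edge_def horiz_edge_def)

text \<open>Both edges contain a vertex of column \<open>Suc n\<close>, which lies outside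
  \<open>grid_verts n\<close>.\<close>

lemma new_edges_notin [simp]:
  "vert_edge (Suc n) \<notin> grid_edges n" "horiz_edge r (Suc n) \<notin> grid_edges n"
  using grid_edges_subset_verts[of "vert_edge (Suc n)" n]
    grid_edges_subset_verts[of "horiz_edge r (Suc n)" n]
  by (auto simp: grid_verts_def vert_edge_def horiz_edge_def)

lemma new_edges_distinct [simp]:
  "vert_edge (Suc n) \<noteq> horiz_edge r (Suc n)" "horiz_edge r (Suc n) \<noteq> vert_edge (Suc n)"
  "horiz_edge r (Suc n) = horiz_edge s (Suc n) \<longleftrightarrow> r = s"
  by (auto simp: vert_edge_def horiz_edge_def doubleton_eq_iff)

lemma mem_vert_edge: "(r, k) \<in> vert_edge l \<longleftrightarrow> k = l \<and> (r = 1 \<or> r = 2)"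
  by (auto simp: vert_edge_def)

lemma mem_horiz_edge_Suc: "(r, k) \<in> horiz_edge s (Suc l) \<longleftrightarrow> r = s \<and> (k = l \<or> k = Suc l)"
  by (auto simp: horiz_edge_def)

text \<open>The sum in the condition of \<open>dimer_covers\<close>, with the edge set as a
  parameter so that edges can be added one at a time.\<close>

definition degree_at :: "'v set set \<Rightarrow> ('v set \<Rightarrow> nat) \<Rightarrow> 'v \<Rightarrow> nat" where
  "degree_at E \<omega> v = (\<Sum>e | e \<in> E \<and> v \<in> e. \<omega> e)"

lemma degree_at_insert:
  assumes "finite E" "e \<notin> E"
  shows "degree_at (insert e E) \<omega> v = (if v \<in> e then \<omega> e else 0) + degree_at E \<omega> v"
proof -
  have "{e'. e' \<in> insert e E \<and> v \<in> e'} =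
      (if v \<in> e then insert e {e'. e' \<in> E \<and> v \<in> e'} else {e'. e' \<in> E \<and> v \<in> e'})"
    by auto
  thus ?thesis using assms by (simp add: degree_at_def)
qed

lemma degree_at_cong: "(\<And>e. e \<in> E \<Longrightarrow> \<omega> e = \<omega>' e) \<Longrightarrow> degree_at E \<omega> v = degree_at E \<omega>' v"
  unfolding degree_at_def by (rule sum.cong) auto

lemma degree_at_restrict: "degree_at E (restrict \<omega> E) v = degree_at E \<omega> v"
  by (rule degree_at_cong) simp

lemma degree_at_grid_Suc:
  assumes "r \<in> {1, 2}"
  shows "degree_at (grid_edges (Suc n)) \<omega> (r, k) =
    (if k = Suc n then \<omega> (vert_edge (Suc n)) else 0) +
    (if k = n \<or> k = Suc n then \<omega> (horiz_edge r (Suc n)) else 0) + degree_at (grid_edges n) \<omega> (r, k)"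
  using assms
  by (auto simp: grid_edges_Suc degree_at_insert finite_grid_edges mem_vert_edge mem_horiz_edge_Suc)

lemma degree_at_outside:
  assumes "k > n"
  shows "degree_at (grid_edges n) \<omega> (r, k) = 0"
proof -
  have "{e. e \<in> grid_edges n \<and> (r, k) \<in> e} = {}"
    using assms grid_edges_subset_verts by (fastforce simp: grid_verts_def)
  thus ?thesis unfolding degree_at_def by (simp only: sum.empty)
qed

abbreviation column_covers :: "nat \<Rightarrow> (nat \<Rightarrow> nat) \<Rightarrow> ((nat \<times> nat) set \<Rightarrow> nat) set" where
  "column_covers n x \<equiv> dimer_covers (grid_verts n) (grid_edges n) (column_mult x)"

lemma column_covers_iff:
  "\<omega> \<in> column_covers n x \<longleftrightarrow> \<omega> \<in> extensional (grid_edges n) \<and>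
     (\<forall>k\<le>n. degree_at (grid_edges n) \<omega> (1, k) = x k \<and> degree_at (grid_edges n) \<omega> (2, k) = x k)"
  by (auto simp: dimer_covers_def degree_at_def grid_verts_def column_mult_def PiE_def)

lemma finite_column_covers: "finite (column_covers n x)"
proof (rule finite_dimer_covers)
  show "e \<inter> grid_verts n \<noteq> {}" if "e \<in> grid_edges n" for e
    using grid_edges_subset_verts[OF that] that
    by (auto simp: grid_edges_def vert_edge_def horiz_edge_def)
qed (auto simp: grid_verts_def finite_grid_edges)

text \<open>The bounds on \<open>K\<close> make both truncated subtractions genuine:
  \<open>K \<le> x n\<close> leaves room in column \<open>n\<close>, and
  \<open>K \<le> x (Suc n)\<close> leaves room for the vertical edge.\<close>

lemma column_covers_Suc_iff:
  "\<omega> \<in> column_covers (Suc n) x \<longleftrightarrow>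
    (\<exists>K\<le>min (x n) (x (Suc n)).
       \<omega> (horiz_edge 1 (Suc n)) = K \<and> \<omega> (horiz_edge 2 (Suc n)) = K \<and>
       \<omega> (vert_edge (Suc n)) = x (Suc n) - K \<and>
       \<omega> \<in> extensional (grid_edges (Suc n)) \<and>
       restrict \<omega> (grid_edges n) \<in> column_covers n (x(n := x n - K)))"
proof -
  let ?d = "\<lambda>r k. degree_at (grid_edges n) \<omega> (r, k)"
  let ?v = "\<omega> (vert_edge (Suc n))"
  let ?h = "\<lambda>r. \<omega> (horiz_edge r (Suc n))"
  \<comment> \<open>The new edges do not touch the columns before \<open>n\<close>; column
    \<open>n\<close> gains one horizontal edge per row, and column \<open>Suc n\<close> meets new
    edges only.\<close>
  have "\<omega> \<in> column_covers (Suc n) x \<longleftrightarrow> \<omega> \<in> extensional (grid_edges (Suc n)) \<and>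
      (\<forall>k<n. ?d 1 k = x k \<and> ?d 2 k = x k) \<and> (?h 1 + ?d 1 n = x n \<and> ?h 2 + ?d 2 n = x n) \<and>
      (?v + ?h 1 = x (Suc n) \<and> ?v + ?h 2 = x (Suc n))"
  proof -
    have "(\<forall>k\<le>Suc n. P k) \<longleftrightarrow> (\<forall>k<n. P k) \<and> P n \<and> P (Suc n)" for P :: "nat \<Rightarrow> bool"
      by (metis le_Suc_eq less_or_eq_imp_le order_le_less)
    thus ?thesis
      unfolding column_covers_iff by (simp add: degree_at_grid_Suc degree_at_outside)
  qed
  moreover have "restrict \<omega> (grid_edges n) \<in> column_covers n (x(n := x n - K)) \<longleftrightarrow>
      (\<forall>k<n. ?d 1 k = x k \<and> ?d 2 k = x k) \<and> ?d 1 n = x n - K \<and> ?d 2 n = x n - K" for K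
  proof -
    have "(\<forall>k\<le>n. P k) \<longleftrightarrow> (\<forall>k<n. P k) \<and> P n" for P :: "nat \<Rightarrow> bool"
      by (metis order_le_less)
    thus ?thesis
      unfolding column_covers_iff by (simp add: degree_at_restrict)
  qed
  ultimately show ?thesis by auto
qed

lemma dimer_weight_Suc:
  "dimer_weight (grid_edges (Suc n)) w \<omega> =
     dimer_weight (grid_edges n) w (restrict \<omega> (grid_edges n)) *
     (w (vert_edge (Suc n)) ^ \<omega> (vert_edge (Suc n)) *
      w (horiz_edge 1 (Suc n)) ^ \<omega> (horiz_edge 1 (Suc n)) *
      w (horiz_edge 2 (Suc n)) ^ \<omega> (horiz_edge 2 (Suc n)))"
  by (simp add: dimer_weight_def grid_edges_Suc finite_grid_edges ac_simps)

text \<open>The partition function for arbitrary column multiplicities; the recursion needs this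
  generality because it lowers the multiplicity of the last column.\<close>

definition grid_sum ::
    "((nat \<times> nat) set \<Rightarrow> 'a::comm_semiring_1) \<Rightarrow> nat \<Rightarrow> (nat \<Rightarrow> nat) \<Rightarrow> 'a" where
  "grid_sum w n x = (\<Sum>\<omega> \<in> column_covers n x. dimer_weight (grid_edges n) w \<omega>)"

text \<open>The single edge carries the whole degree of both vertices, so there is exactly one
  cover.\<close>

lemma grid_sum_0: "grid_sum w 0 x = w (vert_edge 0) ^ x 0"
proof -
  have "degree_at (grid_edges 0) \<omega> (r, 0) = \<omega> (vert_edge 0)" if "r \<in> {1, 2}" for \<omega> r
    using that degree_at_insert[of "{}" "vert_edge 0"]
    by (auto simp: grid_edges_0 mem_vert_edge degree_at_def)
  hence "column_covers 0 x = {restrict (\<lambda>_. x 0) (grid_edges 0)}"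
    unfolding set_eq_iff column_covers_iff
    by (auto simp: grid_edges_0 extensional_def fun_eq_iff)
  thus ?thesis by (simp add: grid_sum_def dimer_weight_def grid_edges_0)
qed

text \<open>Covers of the longer grid correspond bijectively to pairs of a horizontal multiplicity
  \<open>K\<close> and a cover of the shorter grid; \<open>?cut\<close> and \<open>?ext\<close> are
  the two directions.\<close>

lemma grid_sum_Suc:
  "grid_sum w (Suc n) x =
    (\<Sum>K\<le>min (x n) (x (Suc n)). grid_sum w n (x(n := x n - K)) *
       (w (horiz_edge 2 (Suc n)) * w (horiz_edge 1 (Suc n))) ^ K *
       w (vert_edge (Suc n)) ^ (x (Suc n) - K))"
proof -
  let ?v = "vert_edge (Suc n)" and ?h = "\<lambda>r. horiz_edge r (Suc n)"
  let ?I = "{..min (x n) (x (Suc n))}"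
  let ?C = "\<lambda>K. column_covers n (x(n := x n - K))"
  let ?ext = "\<lambda>(K, \<sigma>). \<sigma>(?h 1 := K, ?h 2 := K, ?v := x (Suc n) - K)"
  let ?cut = "\<lambda>\<omega>. (\<omega> (?h 1), restrict \<omega> (grid_edges n))"
  let ?f = "\<lambda>K \<sigma>. dimer_weight (grid_edges n) w \<sigma> *
    (w (?h 2) * w (?h 1)) ^ K * w ?v ^ (x (Suc n) - K)"
  \<comment> \<open>The three updates happen outside \<open>grid_edges n\<close>, and there
    restriction restores the value \<open>undefined\<close> that \<open>\<sigma>\<close> already
    has.\<close>
  have ext_restrict: "restrict (?ext (K, \<sigma>)) (grid_edges n) = \<sigma>"
    if "\<sigma> \<in> extensional (grid_edges n)" for K \<sigma>
    using that by (auto simp: fun_eq_iff extensional_def restrict_def)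
  have "grid_sum w (Suc n) x = (\<Sum>(K, \<sigma>) \<in> Sigma ?I ?C. ?f K \<sigma>)"
    unfolding grid_sum_def
  proof (rule sum.reindex_bij_witness[of _ ?ext ?cut])
    fix \<omega> assume "\<omega> \<in> column_covers (Suc n) x"
    then obtain K where K: "K \<le> min (x n) (x (Suc n))" "\<omega> (?h 1) = K" "\<omega> (?h 2) = K"
      "\<omega> ?v = x (Suc n) - K" "\<omega> \<in> extensional (grid_edges (Suc n))"
      "restrict \<omega> (grid_edges n) \<in> ?C K"
      unfolding column_covers_Suc_iff by blast
    show "?ext (?cut \<omega>) = \<omega>"
      using K by (auto simp: fun_eq_iff grid_edges_Suc extensional_def)
    show "?cut \<omega> \<in> Sigma ?I ?C" using K by simp
    show "(case ?cut \<omega> of (K, \<sigma>) \<Rightarrow> ?f K \<sigma>) = dimer_weight (grid_edges (Suc n)) w \<omega>"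
      using K by (simp add: dimer_weight_Suc power_mult_distrib ac_simps)
  next
    fix p assume "p \<in> Sigma ?I ?C"
    then obtain K \<sigma> where p: "p = (K, \<sigma>)" "K \<in> ?I" "\<sigma> \<in> ?C K" by blast
    have e: "\<sigma> \<in> extensional (grid_edges n)" using p(3) by (simp add: column_covers_iff)
    show "?cut (?ext p) = p"
      using ext_restrict[OF e, of K] by (simp add: p(1))
    have "?ext p \<in> extensional (grid_edges (Suc n))"
      using e by (auto simp: p(1) extensional_def grid_edges_Suc)
    thus "?ext p \<in> column_covers (Suc n) x"
      unfolding column_covers_Suc_iff using p ext_restrict[OF e, of K]
      by (intro exI[of _ K]) auto
  qed
  also have "\<dots> = (\<Sum>K\<in>?I. \<Sum>\<sigma>\<in>?C K. ?f K \<sigma>)"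
    by (subst sum.Sigma) (auto simp: finite_column_covers)
  finally show ?thesis
    by (simp add: grid_sum_def sum_distrib_right)
qed

lemma X_mat_carrier: "X_mat m a b c n \<in> carrier_mat (m 0 + 1) (m n + 1)"
  by (induction n) (auto simp: U_mat_def T_mat_def)

lemma mat_mult_index:
  assumes "i < dim_row A" "j < dim_col B" "dim_col A = dim_row B"
  shows "(A * B) $$ (i, j) = (\<Sum>l<dim_row B. A $$ (i, l) * B $$ (l, j))"
  using assms by (simp add: scalar_prod_def lessThan_atLeast0)

text \<open>Multiplying by \<open>T_mat\<close> scales column \<open>k\<close> by
  \<open>t ^ k\<close> and drops the columns beyond \<open>p\<close>; the zeros of
  \<open>U_mat\<close> impose \<open>k \<le> q - j\<close>. These cutoffs mirror the two bounds on
  \<open>K\<close> in \<open>grid_sum_Suc\<close>.\<close>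

lemma mult_T_mat_U_mat_index:
  assumes A: "A \<in> carrier_mat r (p + 1)" and i: "i < r" and j: "j \<le> q"
  shows "(A * T_mat p q t * U_mat q s) $$ (i, j) =
    (\<Sum>k\<le>min p (q - j). A $$ (i, k) * t ^ k * s ^ (q - j - k))"
proof -
  have AT: "(A * T_mat p q t) $$ (i, k) = (if k \<le> p then A $$ (i, k) * t ^ k else 0)" if "k \<le> q" for k
  proof -
    have "(A * T_mat p q t) $$ (i, k) = (\<Sum>l<p+1. A $$ (i, l) * (if l = k then t ^ l else 0))"
      using A i that by (subst mat_mult_index) (auto simp: T_mat_def intro!: sum.cong)
    also have "\<dots> = (\<Sum>l<p+1. if l = k then A $$ (i, l) * t ^ l else 0)"
      by (intro sum.cong) auto
    finally show ?thesis by auto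
  qed
  have "(A * T_mat p q t * U_mat q s) $$ (i, j) =
      (\<Sum>k<q+1. (A * T_mat p q t) $$ (i, k) * (if k + j \<le> q then s ^ (q - k - j) else 0))"
    using A i j by (subst mat_mult_index) (auto simp: T_mat_def U_mat_def intro!: sum.cong)
  also have "\<dots> = (\<Sum>k\<le>min p (q - j). A $$ (i, k) * t ^ k * s ^ (q - j - k))"
    using j by (intro sum.mono_neutral_cong_right) (auto simp: AT add.commute)
  finally show ?thesis .
qed

text \<open>The case distinction matters only for \<open>n = 0\<close>, where both updates hit the same column and
  the truncated subtraction \<open>m 0 - i - j\<close> must not be mistaken for a valid multiplicity.\<close>

lemma X_mat_index:
  fixes a b c :: "nat \<Rightarrow> 'a::comm_semiring_1"
  assumes "\<And>k. k \<le> n \<Longrightarrow> w (vert_edge k) = a k"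
    and "\<And>k. k \<in> {1..n} \<Longrightarrow> w (horiz_edge 2 k) = b k"
    and "\<And>k. k \<in> {1..n} \<Longrightarrow> w (horiz_edge 1 k) = c k"
    and "i \<le> m 0" and "j \<le> m n" and x: "x = m(0 := m 0 - i)"
  shows "X_mat m a b c n $$ (i, j) = (if j \<le> x n then grid_sum w n (x(n := x n - j)) else 0)"
  using assms(1-5)
\<comment> \<open>The matrix product runs over all entries of row \<open>i\<close> of the previous
  matrix, so the column index must vary.\<close>
proof (induction n arbitrary: j)
  case 0
  thus ?case by (auto simp: U_mat_def grid_sum_0 x)
next
  case (Suc n)
  let ?X = "X_mat m a b c n"
  let ?g = "\<lambda>k. (b (Suc n) * c (Suc n)) ^ k * a (Suc n) ^ (m (Suc n) - j - k)"
  have xs: "x (Suc n) = m (Suc n)" "x n \<le> m n" by (auto simp: x)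
  have IH: "?X $$ (i, k) = (if k \<le> x n then grid_sum w n (x(n := x n - k)) else 0)"
    if "k \<le> m n" for k
    using Suc.IH Suc.prems that by simp
  \<comment> \<open>The shorter grid has no vertex in column \<open>Suc n\<close>, so a change of
    multiplicity there goes unnoticed.\<close>
  have drop: "grid_sum w n (y(Suc n := z)) = grid_sum w n y" for y z
    by (simp add: grid_sum_def dimer_covers_def grid_verts_def column_mult_def)
  have "X_mat m a b c (Suc n) $$ (i, j) =
      (\<Sum>k\<le>min (m n) (m (Suc n) - j). ?X $$ (i, k) * ?g k)"
    using Suc.prems by (simp add: mult_T_mat_U_mat_index[OF X_mat_carrier] mult.assoc)
  \<comment> \<open>By \<open>IH\<close> the terms with \<open>x n < k\<close> vanish, which
    shortens the range to the one in \<open>grid_sum_Suc\<close>.\<close>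
  also have "\<dots> = (\<Sum>k\<le>min (x n) (m (Suc n) - j). grid_sum w n (x(n := x n - k)) * ?g k)"
    using xs by (intro sum.mono_neutral_cong_right) (auto simp: IH)
  also have "\<dots> = grid_sum w (Suc n) (x(Suc n := x (Suc n) - j))"
    using Suc.prems(1)[of "Suc n"] Suc.prems(2,3)[of "Suc n"]
    by (simp add: grid_sum_Suc xs fun_upd_twist[of "Suc n" n] drop mult.assoc)
  finally show ?case using Suc.prems xs by simp
qed

theorem theorem2:
  fixes n :: nat and m :: "nat \<Rightarrow> nat"
    and a b c :: "nat \<Rightarrow> 'a::comm_semiring_1"
    and w :: "(nat \<times> nat) set \<Rightarrow> 'a"
    and i j :: nat
  assumes "n \<ge> 1"
    and "\<And>k. k \<le> n \<Longrightarrow> w (vert_edge k) = a k"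
    and "\<And>k. k \<in> {1..n} \<Longrightarrow> w (horiz_edge 2 k) = b k"
    and "\<And>k. k \<in> {1..n} \<Longrightarrow> w (horiz_edge 1 k) = c k"
    and "i \<in> {1..m 0 + 1}" and "j \<in> {1..m n + 1}"
  shows "X_mat m a b c n $$ (i - 1, j - 1) =
    (\<Sum>\<omega> \<in> grid_dimer_covers n m i j. dimer_weight (grid_edges n) w \<omega>)"
proof -
  let ?x = "m(0 := m 0 - (i - 1))"
  \<comment> \<open>Since \<open>n \<ge> 1\<close>, the update at 0 leaves
    \<open>?x n = m n\<close>; the shift by 1 passes from numbering entries from 1 to numbering them
    from 0.\<close>
  have "m(0 := m 0 + 1 - i, n := m n + 1 - j) = ?x(n := ?x n - (j - 1))"
    using assms(1,5,6) by (auto simp: fun_eq_iff)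
  moreover have "X_mat m a b c n $$ (i - 1, j - 1) = grid_sum w n (?x(n := ?x n - (j - 1)))"
    using X_mat_index[of n w a b c "i - 1" m "j - 1" ?x] assms by auto
  ultimately show ?thesis
    by (simp add: grid_sum_def grid_dimer_covers_def)
qed

end
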